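(* The category $\mathcal{L}\mathrm{ens}$ has a terminal object.
   Context: All categories that are objects of $\mathcal{L}\mathrm{ens}$ are small. A (delta) lens $(f,\varphi)\colon A \rightleftharpoons B$ between small categories consists of a functor $f\colon A\to B$ together with a lifting operation assigning to each pair ($a\in A$, $u\colon fa\to b$ in $B$) a morphism $\varphi(a,u)\colon a\to a'$ of $A$ with domain $a$, such that (1) $f\varphi(a,u)=u$; (2) $\varphi(a,1_{fa})=1_a$; (3) $\varphi(a,v\circ u)=\varphi(a',v)\circ\varphi(a,u)$, where $a'$ is the codomain of $\varphi(a,u)$. $\mathcal{L}\mathrm{ens}$ is the category with small categories as objects and lenses as morphisms; the composite of $(f,\varphi)\colon A\rightleftharpoons B$ and $(g,\gamma)\colon B\rightleftharpoons C$ is the functor $g\circ f$ with lifting operation $(a,u\colon gfa\to c)\mapsto \varphi(a,\gamma(fa,u))$, and the identity lens on $A$ is the identity functor with lifting operation $(a,u)\mapsto u$. *)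

theory Defs
  imports Main "HOL-Library.FuncSet"
begin

text \<open>
  Categories are given by a set of objects and a set of arrows.  All structure maps are required to
  be extensional (equal to \<^term>\<open>undefined\<close> outside their mathematical domain), so that two
  categories are equal as records iff they are equal as categories; the same convention is used for
  functors and lenses.  In \<open>Comp\<close> a pair \<open>(g, f)\<close> stands for \<open>g \<circ> f\<close>, first \<open>f\<close>.
\<close>

record ('o, 'm) cat =
  Obj :: "'o set"
  Arr :: "'m set"
  Dom :: "'m \<Rightarrow> 'o"
  Cod :: "'m \<Rightarrow> 'o"
  Id :: "'o \<Rightarrow> 'm"
  Comp :: "'m \<times> 'm \<Rightarrow> 'm"

definition hom :: "('o, 'm) cat \<Rightarrow> 'o \<Rightarrow> 'o \<Rightarrow> 'm set" where
  "hom C a b = {f \<in> Arr C. Dom C f = a \<and> Cod C f = b}"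

definition composable :: "('o, 'm) cat \<Rightarrow> ('m \<times> 'm) set" where
  "composable C = {(g, f). f \<in> Arr C \<and> g \<in> Arr C \<and> Cod C f = Dom C g}"

locale category =
  fixes C :: "('o, 'm) cat"
  assumes Dom_ext: "Dom C \<in> Arr C \<rightarrow>\<^sub>E Obj C"
    and Cod_ext: "Cod C \<in> Arr C \<rightarrow>\<^sub>E Obj C"
    and Id_ext: "Id C \<in> extensional (Obj C)"
    and Comp_ext: "Comp C \<in> extensional (composable C)"
    and Id_hom: "a \<in> Obj C \<Longrightarrow> Id C a \<in> hom C a a"
    and Comp_hom: "\<lbrakk>f \<in> hom C a b; g \<in> hom C b c\<rbrakk> \<Longrightarrow> Comp C (g, f) \<in> hom C a c"
    and Comp_Id_right: "f \<in> hom C a b \<Longrightarrow> Comp C (f, Id C a) = f"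
    and Comp_Id_left: "f \<in> hom C a b \<Longrightarrow> Comp C (Id C b, f) = f"
    and Comp_assoc: "\<lbrakk>f \<in> hom C a b; g \<in> hom C b c; h \<in> hom C c d\<rbrakk> \<Longrightarrow>
      Comp C (h, Comp C (g, f)) = Comp C (Comp C (h, g), f)"

definition terminal_object :: "('o, 'm) cat \<Rightarrow> 'o \<Rightarrow> bool" where
  "terminal_object C t \<longleftrightarrow> t \<in> Obj C \<and> (\<forall>a \<in> Obj C. \<exists>!f. f \<in> hom C a t)"

locale cat_functor = A: category A + B: category B
  for A :: "('o, 'm) cat" and B :: "('p, 'q) cat"
    and F :: "'o \<Rightarrow> 'p" and G :: "'m \<Rightarrow> 'q" +
  assumes F_ext: "F \<in> Obj A \<rightarrow>\<^sub>E Obj B"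
    and G_ext: "G \<in> extensional (Arr A)"
    and G_hom: "x \<in> hom A a a' \<Longrightarrow> G x \<in> hom B (F a) (F a')"
    and G_Id: "a \<in> Obj A \<Longrightarrow> G (Id A a) = Id B (F a)"
    and G_Comp: "\<lbrakk>x \<in> hom A a a'; y \<in> hom A a' a''\<rbrakk> \<Longrightarrow> G (Comp A (y, x)) = Comp B (G y, G x)"

record ('o, 'm, 'p, 'q) lens_data =
  FObj :: "'o \<Rightarrow> 'p"
  FArr :: "'m \<Rightarrow> 'q"
  Lift :: "'o \<times> 'q \<Rightarrow> 'm"

text \<open>The pairs \<open>(a, u)\<close> with \<open>a\<close> an object of \<open>A\<close> and \<open>u: F a \<rightarrow> b\<close> in \<open>B\<close>, for some \<open>b\<close>.\<close>

definition lift_pairs :: "('o, 'm) cat \<Rightarrow> ('p, 'q) cat \<Rightarrow> ('o \<Rightarrow> 'p) \<Rightarrow> ('o \<times> 'q) set" where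
  "lift_pairs A B F = {(a, u). a \<in> Obj A \<and> u \<in> Arr B \<and> Dom B u = F a}"

locale delta_lens = cat_functor A B "FObj l" "FArr l"
  for A :: "('o, 'm) cat" and B :: "('p, 'q) cat" and l :: "('o, 'm, 'p, 'q) lens_data" +
  assumes Lift_ext: "Lift l \<in> lift_pairs A B (FObj l) \<rightarrow>\<^sub>E Arr A"
    and Dom_Lift: "(a, u) \<in> lift_pairs A B (FObj l) \<Longrightarrow> Dom A (Lift l (a, u)) = a"
    and FArr_Lift: "(a, u) \<in> lift_pairs A B (FObj l) \<Longrightarrow> FArr l (Lift l (a, u)) = u"
    and Lift_Id: "a \<in> Obj A \<Longrightarrow> Lift l (a, Id B (FObj l a)) = Id A a"
    and Lift_Comp: "\<lbrakk>a \<in> Obj A; u \<in> hom B (FObj l a) b; v \<in> hom B b c\<rbrakk> \<Longrightarrow>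
      Lift l (a, Comp B (v, u)) = Comp A (Lift l (Cod A (Lift l (a, u)), v), Lift l (a, u))"

definition lens_id :: "('o, 'm) cat \<Rightarrow> ('o, 'm, 'o, 'm) lens_data" where
  "lens_id A =
    \<lparr>FObj = \<lambda>a \<in> Obj A. a,
     FArr = \<lambda>x \<in> Arr A. x,
     Lift = \<lambda>(a, u) \<in> lift_pairs A A (\<lambda>a. a). u\<rparr>"

definition lens_comp :: "('o, 'm) cat \<Rightarrow> ('r, 's) cat \<Rightarrow> ('p, 'q, 'r, 's) lens_data \<Rightarrow>
    ('o, 'm, 'p, 'q) lens_data \<Rightarrow> ('o, 'm, 'r, 's) lens_data" where
  "lens_comp A C g f =
    \<lparr>FObj = \<lambda>a \<in> Obj A. FObj g (FObj f a),
     FArr = \<lambda>x \<in> Arr A. FArr g (FArr f x),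
     Lift = \<lambda>(a, u) \<in> lift_pairs A C (\<lambda>a. FObj g (FObj f a)). Lift f (a, Lift g (FObj f a, u))\<rparr>"

text \<open>
  The category of small categories and lenses.  An arrow is a triple consisting of its source, its
  target and a lens between them.  The size condition is expressed by types: the small categories
  are those whose objects and arrows form sets of elements of the arbitrary types \<open>'o\<close> and \<open>'m\<close>,
  which thus play the role of the universe.
\<close>

type_synonym ('o, 'm) lens_arr =
  "('o, 'm) cat \<times> ('o, 'm) cat \<times> ('o, 'm, 'o, 'm) lens_data"

definition lens_arrs :: "('o, 'm) lens_arr set" where
  "lens_arrs = {(A, B, l). delta_lens A B l}"

definition Lens :: "(('o, 'm) cat, ('o, 'm) lens_arr) cat" where
  "Lens =
    \<lparr>Obj = {A. category A},
     Arr = lens_arrs,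
     Dom = \<lambda>(A, B, l) \<in> lens_arrs. A,
     Cod = \<lambda>(A, B, l) \<in> lens_arrs. B,
     Id = \<lambda>A \<in> {A. category A}. (A, A, lens_id A),
     Comp = \<lambda>((B', C, g), (A, B, f)) \<in>
         {((B', C, g), (A, B, f)). delta_lens A B f \<and> delta_lens B' C g \<and> B = B'}.
       (A, C, lens_comp A C g f)\<rparr>"

lemma lift_pairsI: "\<lbrakk>a \<in> Obj A; u \<in> hom B (F a) b\<rbrakk> \<Longrightarrow> (a, u) \<in> lift_pairs A B F"
  by (auto simp: lift_pairs_def hom_def)

lemma lift_pairs_cong: "(\<And>a. a \<in> Obj A \<Longrightarrow> F a = F' a) \<Longrightarrow> lift_pairs A B F = lift_pairs A B F'"
  by (auto simp: lift_pairs_def)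

lemma (in category) hom_Obj: "x \<in> hom C a b \<Longrightarrow> a \<in> Obj C \<and> b \<in> Obj C"
  using Dom_ext Cod_ext by (auto simp: hom_def)

lemma (in category) Arr_hom: "x \<in> Arr C \<Longrightarrow> x \<in> hom C (Dom C x) (Cod C x)"
  by (auto simp: hom_def)

lemma (in category) hom_Arr: "x \<in> hom C a b \<Longrightarrow> x \<in> Arr C"
  by (auto simp: hom_def)

lemma (in category) Comp_Arr: "\<lbrakk>f \<in> hom C a b; g \<in> hom C b c\<rbrakk> \<Longrightarrow> Comp C (g, f) \<in> Arr C"
  using Comp_hom hom_Arr by blast

lemma (in delta_lens) FObj_Obj: "a \<in> Obj A \<Longrightarrow> FObj l a \<in> Obj B"
  using F_ext by auto

lemma (in delta_lens) FArr_Arr: "x \<in> Arr A \<Longrightarrow> FArr l x \<in> Arr B"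
  using G_hom[OF A.Arr_hom] B.hom_Arr by blast

lemma (in delta_lens) Lift_Arr:
  "\<lbrakk>a \<in> Obj A; u \<in> hom B (FObj l a) b\<rbrakk> \<Longrightarrow> Lift l (a, u) \<in> Arr A"
  by (rule PiE_mem[OF Lift_ext lift_pairsI])

lemma (in delta_lens) FArr_Lift_hom:
  "\<lbrakk>a \<in> Obj A; u \<in> hom B (FObj l a) b\<rbrakk> \<Longrightarrow> FArr l (Lift l (a, u)) = u"
  by (rule FArr_Lift[OF lift_pairsI])

lemma (in delta_lens) Lift_hom:
  "\<lbrakk>a \<in> Obj A; u \<in> hom B (FObj l a) b\<rbrakk> \<Longrightarrow> Lift l (a, u) \<in> hom A a (Cod A (Lift l (a, u)))"
  using A.Arr_hom[OF Lift_Arr] Dom_Lift[OF lift_pairsI] by fastforce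

lemma (in delta_lens) Lift_Cod:
  assumes "a \<in> Obj A" "u \<in> hom B (FObj l a) b"
  shows "Cod A (Lift l (a, u)) \<in> Obj A" "FObj l (Cod A (Lift l (a, u))) = b"
proof -
  note h = Lift_hom[OF assms]
  show "Cod A (Lift l (a, u)) \<in> Obj A"
    using A.hom_Obj[OF h] by simp
  show "FObj l (Cod A (Lift l (a, u))) = b"
    using G_hom[OF h] FArr_Lift_hom[OF assms] assms(2) by (auto simp: hom_def)
qed

lemma delta_lens_lens_id:
  assumes "category A"
  shows "delta_lens A A (lens_id A)"
proof -
  interpret category A by fact
  have [simp]: "lift_pairs A A (\<lambda>a \<in> Obj A. a) = lift_pairs A A (\<lambda>a. a)"
    by (rule lift_pairs_cong) simp
  show ?thesis
  proof unfold_locales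
    show "FArr (lens_id A) x \<in> hom A (FObj (lens_id A) a) (FObj (lens_id A) a')"
      if "x \<in> hom A a a'" for x a a'
      using that hom_Obj[OF that] hom_Arr[OF that] by (simp add: lens_id_def)
  next
    show "FArr (lens_id A) (Id A a) = Id A (FObj (lens_id A) a)" if "a \<in> Obj A" for a
      using that hom_Arr[OF Id_hom[OF that]] by (simp add: lens_id_def)
  next
    show "FArr (lens_id A) (Comp A (y, x)) = Comp A (FArr (lens_id A) y, FArr (lens_id A) x)"
      if "x \<in> hom A a a'" "y \<in> hom A a' a''" for x y a a' a''
      using that hom_Arr Comp_Arr by (simp add: lens_id_def)
  next
    show "Lift (lens_id A) (a, Id A (FObj (lens_id A) a)) = Id A a" if "a \<in> Obj A" for a
      using that Id_hom[OF that] by (auto simp: lens_id_def lift_pairs_def hom_def)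
  next
    fix a u b v c
    assume *: "a \<in> Obj A" "u \<in> hom A (FObj (lens_id A) a) b" "v \<in> hom A b c"
    then have u: "u \<in> hom A a b" by (simp add: lens_id_def)
    have vu: "Comp A (v, u) \<in> hom A a c" using Comp_hom u *(3) .
    have "Cod A u \<in> Obj A" "Dom A v = Cod A u"
      using hom_Obj[OF u] u *(3) by (auto simp: hom_def)
    then show "Lift (lens_id A) (a, Comp A (v, u)) =
      Comp A (Lift (lens_id A) (Cod A (Lift (lens_id A) (a, u)), v), Lift (lens_id A) (a, u))"
      using *(1,3) u vu by (auto simp: lens_id_def lift_pairs_def hom_def)
  qed (auto simp: lens_id_def lift_pairs_def split: if_splits)
qed

lemma delta_lens_lens_comp:
  assumes "delta_lens A B f" "delta_lens B C g"
  shows "delta_lens A C (lens_comp A C g f)"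
proof -
  interpret f: delta_lens A B f by fact
  interpret g: delta_lens B C g by fact
  let ?h = "lens_comp A C g f"
  have O: "FObj ?h a = FObj g (FObj f a)" if "a \<in> Obj A" for a
    using that by (simp add: lens_comp_def)
  have R: "FArr ?h x = FArr g (FArr f x)" if "x \<in> Arr A" for x
    using that by (simp add: lens_comp_def)
  have P: "lift_pairs A C (FObj ?h) = lift_pairs A C (\<lambda>a. FObj g (FObj f a))"
    by (rule lift_pairs_cong) (simp add: O)
  have L: "Lift ?h (a, u) = Lift f (a, Lift g (FObj f a, u))"
    if "a \<in> Obj A" "u \<in> hom C (FObj g (FObj f a)) b" for a u b
    using that by (auto simp: lens_comp_def lift_pairs_def hom_def)
  have LP: "\<exists>b. a \<in> Obj A \<and> u \<in> hom C (FObj g (FObj f a)) b"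
    if "(a, u) \<in> lift_pairs A C (FObj ?h)" for a u
    using that unfolding P by (auto simp: lift_pairs_def hom_def)
  note gl = g.Lift_hom[OF f.FObj_Obj]
  show ?thesis
  proof unfold_locales
    show "FObj ?h \<in> Obj A \<rightarrow>\<^sub>E Obj C"
      using f.FObj_Obj g.FObj_Obj by (auto simp: lens_comp_def)
    show "FArr ?h \<in> extensional (Arr A)"
      by (simp add: lens_comp_def)
    show "FArr ?h x \<in> hom C (FObj ?h a) (FObj ?h a')" if "x \<in> hom A a a'" for x a a'
      using g.G_hom[OF f.G_hom[OF that]] f.A.hom_Obj[OF that] f.A.hom_Arr[OF that]
      by (simp add: O R)
    show "FArr ?h (Id A a) = Id C (FObj ?h a)" if "a \<in> Obj A" for a
      using that f.A.hom_Arr[OF f.A.Id_hom[OF that]] f.FObj_Obj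
      by (simp add: O R f.G_Id g.G_Id)
    show "FArr ?h (Comp A (y, x)) = Comp C (FArr ?h y, FArr ?h x)"
      if "x \<in> hom A a a'" "y \<in> hom A a' a''" for x y a a' a''
      using f.A.Comp_Arr[OF that] f.A.hom_Arr[OF that(1)] f.A.hom_Arr[OF that(2)]
      by (simp add: R f.G_Comp[OF that] g.G_Comp[OF f.G_hom[OF that(1)] f.G_hom[OF that(2)]])
    show "Lift ?h \<in> lift_pairs A C (FObj ?h) \<rightarrow>\<^sub>E Arr A"
    proof (rule PiE_I)
      fix p assume "p \<in> lift_pairs A C (FObj ?h)"
      then obtain a u b where p: "p = (a, u)" "a \<in> Obj A" "u \<in> hom C (FObj g (FObj f a)) b"
        using LP by (cases p) blast
      then show "Lift ?h p \<in> Arr A"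
        using f.Lift_Arr[OF p(2) gl[OF p(2,3)]] L[OF p(2,3)] by simp
    next
      fix p assume "p \<notin> lift_pairs A C (FObj ?h)"
      then show "Lift ?h p = undefined"
        unfolding P by (simp add: lens_comp_def)
    qed
    show "Dom A (Lift ?h (a, u)) = a" if p_in: "(a, u) \<in> lift_pairs A C (FObj ?h)" for a u
    proof -
      obtain b where b: "a \<in> Obj A" "u \<in> hom C (FObj g (FObj f a)) b" using LP p_in by blast
      show ?thesis using f.Lift_hom[OF b(1) gl[OF b]] L[OF b] by (simp add: hom_def)
    qed
    show "FArr ?h (Lift ?h (a, u)) = u" if p_in: "(a, u) \<in> lift_pairs A C (FObj ?h)" for a u
    proof -
      obtain b where b: "a \<in> Obj A" "u \<in> hom C (FObj g (FObj f a)) b" using LP p_in by blast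
      show ?thesis
        using f.FArr_Lift_hom[OF b(1) gl[OF b]] f.Lift_Arr[OF b(1) gl[OF b]]
          g.FArr_Lift_hom[OF f.FObj_Obj[OF b(1)] b(2)] L[OF b]
        by (simp add: R)
    qed
    show "Lift ?h (a, Id C (FObj ?h a)) = Id A a" if "a \<in> Obj A" for a
      using L[OF that g.B.Id_hom[OF g.FObj_Obj[OF f.FObj_Obj[OF that]]]] that f.FObj_Obj[OF that]
      by (simp add: O f.Lift_Id g.Lift_Id)
    show "Lift ?h (a, Comp C (v, u)) = Comp A (Lift ?h (Cod A (Lift ?h (a, u)), v), Lift ?h (a, u))"
      if "a \<in> Obj A" "u \<in> hom C (FObj ?h a) b" "v \<in> hom C b c" for a u b v c
    proof -
      have u: "u \<in> hom C (FObj g (FObj f a)) b" using that by (simp add: O)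
      have fa: "FObj f a \<in> Obj B" using f.FObj_Obj that(1) .
      define w where "w = Lift g (FObj f a, u)"
      define a' where "a' = Cod A (Lift f (a, w))"
      have w: "w \<in> hom B (FObj f a) (Cod B w)" using gl[OF that(1) u] by (simp add: w_def)
      have cw: "FObj g (Cod B w) = b" using g.Lift_Cod(2)[OF fa u] by (simp add: w_def)
      have cw': "Cod B w \<in> Obj B" using g.Lift_Cod(1)[OF fa u] by (simp add: w_def)
      have a': "a' \<in> Obj A" "FObj f a' = Cod B w"
        using f.Lift_Cod[OF that(1) w] by (simp_all add: a'_def)
      have v: "v \<in> hom C (FObj g (FObj f a')) c" using that(3) a' cw by simp
      have lv: "Lift g (Cod B w, v) \<in> hom B (Cod B w) (Cod B (Lift g (Cod B w, v)))"
        using gl[OF a'(1) v] a' by simp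
      have "Lift ?h (a, Comp C (v, u)) = Lift f (a, Lift g (FObj f a, Comp C (v, u)))"
        using L[OF that(1) g.B.Comp_hom[OF u that(3)]] .
      also have "\<dots> = Lift f (a, Comp B (Lift g (Cod B w, v), w))"
        using g.Lift_Comp[OF fa u that(3)] by (simp add: w_def)
      also have "\<dots> = Comp A (Lift f (a', Lift g (Cod B w, v)), Lift f (a, w))"
        using f.Lift_Comp[OF that(1) w lv] by (simp add: a'_def)
      finally show ?thesis
        using L[OF that(1) u] L[OF a'(1) v] a' by (simp add: w_def a'_def)
    qed
  qed
qed

lemma hom_Lens: "x \<in> hom Lens A B \<longleftrightarrow> (\<exists>l. x = (A, B, l) \<and> delta_lens A B l)"
  by (auto simp: hom_def Lens_def lens_arrs_def)

lemma Comp_Lens: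
  "\<lbrakk>delta_lens A B f; delta_lens B C g\<rbrakk> \<Longrightarrow>
    Comp Lens ((B, C, g), (A, B, f)) = (A, C, lens_comp A C g f)"
  by (simp add: Lens_def)

lemma lens_eqI:
  fixes k l :: "('o, 'm, 'p, 'q) lens_data"
  assumes "delta_lens A B k" "delta_lens A B l"
    and O: "\<And>a. a \<in> Obj A \<Longrightarrow> FObj k a = FObj l a"
    and R: "\<And>x. x \<in> Arr A \<Longrightarrow> FArr k x = FArr l x"
    and L: "\<And>a u b. \<lbrakk>a \<in> Obj A; u \<in> hom B (FObj l a) b\<rbrakk> \<Longrightarrow> Lift k (a, u) = Lift l (a, u)"
  shows "k = l"
proof -
  interpret k: delta_lens A B k by fact
  interpret l: delta_lens A B l by fact
  have "FObj k = FObj l" using PiE_ext[OF k.F_ext l.F_ext] O by blast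
  moreover have "FArr k = FArr l" using extensionalityI[OF k.G_ext l.G_ext] R by blast
  moreover have "Lift k = Lift l"
  proof (rule PiE_ext[OF k.Lift_ext])
    show "Lift l \<in> lift_pairs A B (FObj k) \<rightarrow>\<^sub>E Arr A"
      using l.Lift_ext \<open>FObj k = FObj l\<close> by simp
    show "Lift k p = Lift l p" if "p \<in> lift_pairs A B (FObj k)" for p
      using that O L by (cases p) (auto simp: lift_pairs_def hom_def)
  qed
  ultimately show ?thesis by simp
qed

lemma lens_comp_sel:
  assumes "a \<in> Obj A"
  shows "FObj (lens_comp A C g f) a = FObj g (FObj f a)"
    and "u \<in> hom C (FObj g (FObj f a)) b \<Longrightarrow>
      Lift (lens_comp A C g f) (a, u) = Lift f (a, Lift g (FObj f a, u))"
  using assms by (auto simp: lens_comp_def lift_pairs_def hom_def)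

lemma lens_comp_FArr: "x \<in> Arr A \<Longrightarrow> FArr (lens_comp A C g f) x = FArr g (FArr f x)"
  by (simp add: lens_comp_def)

lemma lens_id_sel:
  assumes "a \<in> Obj A"
  shows "FObj (lens_id A) a = a" "u \<in> hom A a b \<Longrightarrow> Lift (lens_id A) (a, u) = u"
  using assms by (auto simp: lens_id_def lift_pairs_def hom_def)

lemma lens_id_FArr: "x \<in> Arr A \<Longrightarrow> FArr (lens_id A) x = x"
  by (simp add: lens_id_def)

theorem category_Lens: "category (Lens :: (('o, 'm) cat, ('o, 'm) lens_arr) cat)"
proof
  let ?L = "Lens :: (('o, 'm) cat, ('o, 'm) lens_arr) cat"
  show "Dom ?L \<in> Arr ?L \<rightarrow>\<^sub>E Obj ?L" "Cod ?L \<in> Arr ?L \<rightarrow>\<^sub>E Obj ?L"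
    by (auto simp: Lens_def lens_arrs_def delta_lens_def cat_functor_def)
  show "Id ?L \<in> extensional (Obj ?L)"
    by (simp add: Lens_def)
  show "Comp ?L \<in> extensional (composable ?L)"
    by (auto simp: extensional_def composable_def Lens_def lens_arrs_def)
  show "Id ?L A \<in> hom ?L A A" if "A \<in> Obj ?L" for A
    using that delta_lens_lens_id by (auto simp: hom_Lens) (simp_all add: Lens_def)
  show "Comp ?L (y, x) \<in> hom ?L A C" if "x \<in> hom ?L A B" "y \<in> hom ?L B C" for x y A B C
    using that delta_lens_lens_comp by (auto simp: hom_Lens Comp_Lens)
  show "Comp ?L (x, Id ?L A) = x" if x_in: "x \<in> hom ?L A B" for x A B
  proof -
    obtain l where x: "x = (A, B, l)" and l: "delta_lens A B l" using x_in by (auto simp: hom_Lens)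
    interpret delta_lens A B l by fact
    note i = delta_lens_lens_id[OF A.category_axioms]
    have "lens_comp A B l (lens_id A) = l"
      by (rule lens_eqI[OF delta_lens_lens_comp[OF i l] l])
        (simp_all add: lens_comp_sel lens_comp_FArr lens_id_sel(1) lens_id_FArr
          lens_id_sel(2)[OF _ Lift_hom])
    then show ?thesis
      using Comp_Lens[OF i l] A.category_axioms by (simp add: x) (simp add: Lens_def)
  qed
  show "Comp ?L (Id ?L B, x) = x" if x_in: "x \<in> hom ?L A B" for x A B
  proof -
    obtain l where x: "x = (A, B, l)" and l: "delta_lens A B l" using x_in by (auto simp: hom_Lens)
    interpret delta_lens A B l by fact
    note i = delta_lens_lens_id[OF B.category_axioms]
    have "lens_comp A B (lens_id B) l = l"
      by (rule lens_eqI[OF delta_lens_lens_comp[OF l i] l])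
        (simp_all add: lens_comp_sel lens_comp_FArr lens_id_sel lens_id_FArr FObj_Obj FArr_Arr)
    then show ?thesis
      using Comp_Lens[OF l i] B.category_axioms by (simp add: x) (simp add: Lens_def)
  qed
  show "Comp ?L (z, Comp ?L (y, x)) = Comp ?L (Comp ?L (z, y), x)"
    if x_in: "x \<in> hom ?L A B" "y \<in> hom ?L B C" "z \<in> hom ?L C D" for x y z A B C D
  proof -
    obtain f g h where x: "x = (A, B, f)" "y = (B, C, g)" "z = (C, D, h)"
      and f: "delta_lens A B f" and g: "delta_lens B C g" and h: "delta_lens C D h"
      using x_in by (auto simp: hom_Lens)
    interpret f: delta_lens A B f by fact
    interpret g: delta_lens B C g by fact
    interpret h: delta_lens C D h by fact
    note gf = delta_lens_lens_comp[OF f g] and hg = delta_lens_lens_comp[OF g h]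
    have "lens_comp A D h (lens_comp A C g f) = lens_comp A D (lens_comp B D h g) f"
    proof (rule lens_eqI[OF delta_lens_lens_comp[OF gf h] delta_lens_lens_comp[OF f hg]])
      fix a u b
      assume a: "a \<in> Obj A" and u: "u \<in> hom D (FObj (lens_comp A D (lens_comp B D h g) f) a) b"
      from a u have u': "u \<in> hom D (FObj h (FObj g (FObj f a))) b"
        by (simp add: lens_comp_sel f.FObj_Obj)
      note lu = h.Lift_hom[OF g.FObj_Obj[OF f.FObj_Obj[OF a]] u']
      show "Lift (lens_comp A D h (lens_comp A C g f)) (a, u) =
        Lift (lens_comp A D (lens_comp B D h g) f) (a, u)"
        using a u' lu f.FObj_Obj[OF a] by (simp add: lens_comp_sel)
    qed (simp_all add: lens_comp_sel lens_comp_FArr f.FObj_Obj f.FArr_Arr)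
    then show ?thesis
      using f g h gf hg by (simp add: x Comp_Lens)
  qed
qed

end

theory Submission
  imports Defs
begin

text \<open>The terminal object is the category with one object \<open>t\<close> and one arrow
  \<open>i\<close>. Into it there is only one functor from any \<open>A\<close>, the constant one.
  The lifting is forced as well: \<open>i\<close> is the identity of \<open>t\<close>, so the only
  lifting problem at an object \<open>a\<close> is that of an identity, and the identity law of
  lenses prescribes the answer \<open>Id A a\<close>. Conversely, lifting everything to identities
  satisfies the lens laws. Existence is \<open>delta_lens_lens_to_one\<close>, uniqueness is
  \<open>lens_to_one_unique\<close>.\<close>

definition one_cat :: "'o \<Rightarrow> 'm \<Rightarrow> ('o, 'm) cat" where
  "one_cat t i =
    \<lparr>Obj = {t},
     Arr = {i},
     Dom = \<lambda>x \<in> {i}. t,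
     Cod = \<lambda>x \<in> {i}. t,
     Id = \<lambda>a \<in> {t}. i,
     Comp = \<lambda>p \<in> {(i, i)}. i\<rparr>"

lemma one_cat_sel [simp]:
  "Obj (one_cat t i) = {t}" "Arr (one_cat t i) = {i}" "Dom (one_cat t i) i = t"
  "Cod (one_cat t i) i = t" "Id (one_cat t i) t = i" "Comp (one_cat t i) (i, i) = i"
  by (simp_all add: one_cat_def)

lemma hom_one_cat: "x \<in> hom (one_cat t i) a b \<longleftrightarrow> x = i \<and> a = t \<and> b = t"
  by (auto simp: hom_def)

lemma category_one_cat: "category (one_cat t i)"
proof
  \<comment> \<open>The only composable pair is \<open>(i, i)\<close>, exactly the domain to which
    \<open>Comp\<close> was restricted.\<close>
  show "Comp (one_cat t i) \<in> extensional (composable (one_cat t i))"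
    by (auto simp: extensional_def composable_def one_cat_def)
qed (auto simp: hom_one_cat, auto simp: one_cat_def)

text \<open>The domain \<open>Obj A \<times> {i}\<close> of \<open>Lift\<close> is
  \<open>lift_pairs\<close> for the constant functor, as extensionality demands.\<close>

definition lens_to_one :: "('o, 'm) cat \<Rightarrow> 'p \<Rightarrow> 'q \<Rightarrow> ('o, 'm, 'p, 'q) lens_data" where
  "lens_to_one A t i =
    \<lparr>FObj = \<lambda>a \<in> Obj A. t,
     FArr = \<lambda>x \<in> Arr A. i,
     Lift = \<lambda>(a, u) \<in> Obj A \<times> {i}. Id A a\<rparr>"

text \<open>Since all lifts are identities, each lens law reduces to a property of identities in
  \<open>A\<close>.\<close>

lemma delta_lens_lens_to_one:
  assumes "category A"
  shows "delta_lens A (one_cat t i) (lens_to_one A t i)"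
proof -
  interpret A: category A by fact
  interpret B: category "one_cat t i" by (rule category_one_cat)
  have P: "lift_pairs A (one_cat t i) (FObj (lens_to_one A t i)) = Obj A \<times> {i}"
    by (auto simp: lift_pairs_def lens_to_one_def)
  note Id = A.Id_hom A.Id_hom[THEN A.hom_Arr]
  show ?thesis
  proof unfold_locales
    show "Lift (lens_to_one A t i) \<in>
      lift_pairs A (one_cat t i) (FObj (lens_to_one A t i)) \<rightarrow>\<^sub>E Arr A"
      unfolding P using Id by (auto simp: lens_to_one_def)
  next
    fix a u b v c
    assume "a \<in> Obj A" "u \<in> hom (one_cat t i) (FObj (lens_to_one A t i) a) b"
      "v \<in> hom (one_cat t i) b c"
    then show "Lift (lens_to_one A t i) (a, Comp (one_cat t i) (v, u)) =
      Comp A (Lift (lens_to_one A t i) (Cod A (Lift (lens_to_one A t i) (a, u)), v),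
        Lift (lens_to_one A t i) (a, u))"
      \<comment> \<open>Both \<open>u\<close> and \<open>v\<close> are \<open>i\<close>, and the
        first lift \<open>Id A a\<close> ends at \<open>a\<close> again, so the claim becomes
        \<open>Id A a = Comp A (Id A a, Id A a)\<close>.\<close>
      using Id(1)[of a] A.Comp_Id_right[OF Id(1)[of a]]
      by (auto simp: lens_to_one_def hom_one_cat hom_def)
  next
    show "FArr (lens_to_one A t i) (Comp A (y, x)) =
      Comp (one_cat t i) (FArr (lens_to_one A t i) y, FArr (lens_to_one A t i) x)"
      if "x \<in> hom A a a'" "y \<in> hom A a' a''" for x y a a' a''
      using A.Comp_Arr[OF that] A.hom_Arr[OF that(1)] A.hom_Arr[OF that(2)]
      by (simp add: lens_to_one_def)
  next
    show "FArr (lens_to_one A t i) x \<in>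
      hom (one_cat t i) (FObj (lens_to_one A t i) a) (FObj (lens_to_one A t i) a')"
      if "x \<in> hom A a a'" for x a a'
      using A.hom_Obj[OF that] A.hom_Arr[OF that] by (simp add: lens_to_one_def hom_one_cat)
  qed (use Id in \<open>auto simp: P, auto simp: lens_to_one_def hom_def\<close>)
qed

text \<open>The lifts are forced because every arrow of the target is an identity.\<close>

lemma lens_to_one_unique:
  fixes k l :: "('o, 'm, 'p, 'q) lens_data"
  assumes k: "delta_lens A (one_cat t i) k" and l: "delta_lens A (one_cat t i) l"
  shows "k = l"
proof -
  interpret k: delta_lens A "one_cat t i" k by fact
  interpret l: delta_lens A "one_cat t i" l by fact
  have O: "FObj k a = t" "FObj l a = t" if "a \<in> Obj A" for a
    using k.FObj_Obj[OF that] l.FObj_Obj[OF that] by simp_all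
  show ?thesis
  proof (rule lens_eqI[OF k l])
    show "FArr k x = FArr l x" if "x \<in> Arr A" for x
      using k.FArr_Arr[OF that] l.FArr_Arr[OF that] by simp
    show "Lift k (a, u) = Lift l (a, u)"
      if "a \<in> Obj A" "u \<in> hom (one_cat t i) (FObj l a) b" for a u b
      using that k.Lift_Id[OF that(1)] l.Lift_Id[OF that(1)] by (simp add: O hom_one_cat)
  qed (simp add: O)
qed

lemma terminal_object_one_cat: "terminal_object Lens (one_cat t i)"
  unfolding terminal_object_def
proof (intro conjI ballI)
  show "one_cat t i \<in> Obj Lens"
    by (simp add: Lens_def category_one_cat)
  show "\<exists>!x. x \<in> hom Lens A (one_cat t i)" if "A \<in> Obj Lens" for A
  proof (rule ex1I)
    from that have "category A" by (simp add: Lens_def)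
    then show "(A, one_cat t i, lens_to_one A t i) \<in> hom Lens A (one_cat t i)"
      by (simp add: hom_Lens delta_lens_lens_to_one)
    \<comment> \<open>By \<open>hom_Lens\<close> only the lens component of \<open>x\<close> is
      open; the chained membership supplies the lens to compare it with.\<close>
    then show "x = (A, one_cat t i, lens_to_one A t i)"
      if "x \<in> hom Lens A (one_cat t i)" for x
      using that lens_to_one_unique by (auto simp: hom_Lens)
  qed
qed

theorem proposition4p1:
  shows "\<exists>T :: ('o, 'm) cat. terminal_object Lens T"
  \<comment> \<open>Any \<open>t\<close> and \<open>i\<close> will do as witnesses; they exist
    because HOL types are nonempty.\<close>
  by (intro exI) (rule terminal_object_one_cat)

end
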